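(* Let $\mathcal{H}$ be a separable complex Hilbert space. Let $A_0$ be a densely defined, closed, symmetric operator in $\mathcal{H}$ with deficiency indices $(1,1)$, and let $A_1$ be a self-adjoint extension of $A_0$ in $\mathcal{H}$. Put $T_j = A_j + iI_{\mathcal{H}}$, $\operatorname{dom}(T_j)=\operatorname{dom}(A_j)$, $j=0,1$. Let $e\in\operatorname{dom}(T_0^* )$ be a vector with $\|e\|_{\mathcal{H}}=1$ and $T_0^*e=0$ (such a vector exists), and define $$T_2 f = T_1 f + (e,T_1 f)_{\mathcal{H}}\, e,\qquad f\in\operatorname{dom}(T_2)=\operatorname{dom}(T_1),$$ which is a densely defined closed operator in $\mathcal{H}$. Let $\mathfrak{E}\subset\mathbb{R}$ be a subset that is not Lebesgue measurable, and define the family of closed, densely defined operators $$\widetilde T(t) = \begin{cases} T_1^*, & t\in\mathfrak{E},\\ T_2^*, & t\in\mathbb{R}\setminus\mathfrak{E}.\end{cases}$$ Then the family $\{\widetilde T(t)\}_{t\in\mathbb{R}}$ is weakly measurable, but the family of adjoint operators $\{(\widetilde T(t))^*\}_{t\in\mathbb{R}}$ is not weakly measurable.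
   Context: The scalar product $(\cdot,\cdot)_{\mathcal{H}}$ is linear in the second argument, and $I_{\mathcal{H}}$ is the identity operator. A family of vectors $\{g(t)\}_{t\in\mathbb{R}}\subset\mathcal{H}$ is called weakly measurable if $t\mapsto (h,g(t))_{\mathcal{H}}$ is Lebesgue measurable for every $h\in\mathcal{H}$. A family $\{T(t)\}_{t\in\mathbb{R}}$ of densely defined, closed, linear operators in $\mathcal{H}$ is called weakly measurable if for every weakly measurable family of vectors $\{f(t)\}_{t\in\mathbb{R}}$ in $\mathcal{H}$ with $f(t)\in\operatorname{dom}(T(t))$ for all $t\in\mathbb{R}$, the family of vectors $\{T(t)f(t)\}_{t\in\mathbb{R}}$ is weakly measurable. *)

theory Defs
  imports "HOL-Analysis.Analysis" "HOL-Library.Extended_Nat"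
begin

section \<open>Complex Hilbert spaces\<close>

class complex_inner = real_normed_vector +
  fixes scaleC :: "complex \<Rightarrow> 'a \<Rightarrow> 'a" (infixr "*\<^sub>C" 75)
    and cinner :: "'a \<Rightarrow> 'a \<Rightarrow> complex"
  assumes scaleC_add_right: "c *\<^sub>C (x + y) = c *\<^sub>C x + c *\<^sub>C y"
    and scaleC_add_left: "(c + d) *\<^sub>C x = c *\<^sub>C x + d *\<^sub>C x"
    and scaleC_scaleC: "c *\<^sub>C d *\<^sub>C x = (c * d) *\<^sub>C x"
    and scaleC_one: "1 *\<^sub>C x = x"
    and scaleR_scaleC: "r *\<^sub>R x = complex_of_real r *\<^sub>C x"
    and cinner_commute: "cinner x y = cnj (cinner y x)"
    and cinner_add_right: "cinner x (y + z) = cinner x y + cinner x z"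
    and cinner_scaleC_right: "cinner x (c *\<^sub>C y) = c * cinner x y"
    and cinner_ge_zero: "0 \<le> Re (cinner x x)"
    and cinner_eq_zero_iff: "cinner x x = 0 \<longleftrightarrow> x = 0"
    and norm_eq_sqrt_cinner: "norm x = sqrt (Re (cinner x x))"

class chilbert_space = complex_inner + banach

global_interpretation complex_vector: vector_space "scaleC :: complex \<Rightarrow> 'a \<Rightarrow> 'a::complex_inner"
  by unfold_locales (rule scaleC_add_right scaleC_add_left scaleC_scaleC scaleC_one)+

section \<open>Unbounded operators\<close>

text \<open>An operator with domain a subset of the space is a partial function \<open>A :: 'h \<rightharpoonup> 'h\<close>
  with domain \<open>dom A\<close>, so that equality and extension of operators are
  equality and \<open>(\<subseteq>\<^sub>m)\<close> of partial functions, with domains taken into account.\<close>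

definition linear_operator :: "('h::complex_inner \<rightharpoonup> 'h) \<Rightarrow> bool" where
  "linear_operator A \<longleftrightarrow>
     complex_vector.subspace (dom A) \<and>
     (\<forall>f\<in>dom A. \<forall>g\<in>dom A. the (A (f + g)) = the (A f) + the (A g)) \<and>
     (\<forall>c. \<forall>f\<in>dom A. the (A (c *\<^sub>C f)) = c *\<^sub>C the (A f))"

definition densely_defined :: "('h::complex_inner \<rightharpoonup> 'h) \<Rightarrow> bool" where
  "densely_defined A \<longleftrightarrow> closure (dom A) = UNIV"

definition closed_operator :: "('h::complex_inner \<rightharpoonup> 'h) \<Rightarrow> bool" where
  "closed_operator A \<longleftrightarrow> closed {(f, g). A f = Some g}"

definition dd_closed_linear :: "('h::complex_inner \<rightharpoonup> 'h) \<Rightarrow> bool" where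
  "dd_closed_linear A \<longleftrightarrow> linear_operator A \<and> densely_defined A \<and> closed_operator A"

text \<open>The vector \<open>k\<close> below is automatically unique if \<open>A\<close> is densely defined, which is the only
  case in which the adjoint is meaningful.\<close>

definition op_adjoint :: "('h::complex_inner \<rightharpoonup> 'h) \<Rightarrow> ('h \<rightharpoonup> 'h)" where
  "op_adjoint A = (\<lambda>g.
     if \<exists>!k. \<forall>f\<in>dom A. cinner g (the (A f)) = cinner k f
     then Some (THE k. \<forall>f\<in>dom A. cinner g (the (A f)) = cinner k f)
     else None)"

definition symmetric_operator :: "('h::complex_inner \<rightharpoonup> 'h) \<Rightarrow> bool" where
  "symmetric_operator A \<longleftrightarrow>
     (\<forall>f\<in>dom A. \<forall>g\<in>dom A. cinner f (the (A g)) = cinner (the (A f)) g)"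

definition self_adjoint :: "('h::complex_inner \<rightharpoonup> 'h) \<Rightarrow> bool" where
  "self_adjoint A \<longleftrightarrow> linear_operator A \<and> densely_defined A \<and> op_adjoint A = A"

definition op_shift :: "('h::complex_inner \<rightharpoonup> 'h) \<Rightarrow> complex \<Rightarrow> ('h \<rightharpoonup> 'h)" where
  "op_shift A z = (\<lambda>f. map_option (\<lambda>y. y + z *\<^sub>C f) (A f))"

definition op_kernel :: "('h::complex_inner \<rightharpoonup> 'h) \<Rightarrow> 'h set" where
  "op_kernel A = {f \<in> dom A. the (A f) = 0}"

text \<open>The library dimension is \<open>0\<close> for infinite-dimensional subspaces, hence the case split.\<close>

definition cdim :: "'h::complex_inner set \<Rightarrow> enat" where
  "cdim V = (if \<exists>B. finite B \<and> complex_vector.span B = V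
             then enat (complex_vector.dim V) else \<infinity>)"

definition deficiency_indices :: "('h::complex_inner \<rightharpoonup> 'h) \<Rightarrow> enat \<times> enat" where
  "deficiency_indices A =
     (cdim (op_kernel (op_shift (op_adjoint A) (- \<i>))),
      cdim (op_kernel (op_shift (op_adjoint A) \<i>)))"

section \<open>Weak measurability\<close>

definition weakly_measurable :: "(real \<Rightarrow> 'h::complex_inner) \<Rightarrow> bool" where
  "weakly_measurable g \<longleftrightarrow> (\<forall>h. (\<lambda>t. cinner h (g t)) \<in> borel_measurable lebesgue)"

text \<open>This notion is meant for families of densely defined, closed, linear operators. That
  requirement is kept out of the definition so that its negation expresses only the failure of
  measurability; it is to be stated separately through \<open>dd_closed_linear\<close>.\<close>

definition weakly_measurable_ops :: "(real \<Rightarrow> ('h::complex_inner \<rightharpoonup> 'h)) \<Rightarrow> bool" where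
  "weakly_measurable_ops T \<longleftrightarrow>
     (\<forall>f. weakly_measurable f \<longrightarrow> (\<forall>t. f t \<in> dom (T t)) \<longrightarrow>
          weakly_measurable (\<lambda>t. the (T t (f t))))"

end

(* Write B f = f + (e, f) e, a bounded self-adjoint bijection, so that T2 = B T1 and T2* = T1* B,
   T2** = B T1** = T2. Since e is orthogonal to ran T0, B acts as the identity on ran T0, hence T1*
   and T2* are both restrictions of T0*. Thus (h, T(t) f(t)) = (T0 h, f(t)) for h in the dense set
   dom T0, whatever E is, and T is weakly measurable. The adjoint family switches between T1 and T2,
   which differ on a vector f with (e, T1 f) = c nonzero: there (e, T(t)* f) is c on E and 2c off E.
   Such an f exists since otherwise the nonreal number i would be an eigenvalue of A1. *)

theory Submission
  imports Defs
begin

section \<open>Complex inner products\<close>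

lemma cinner_add_left:
  fixes x y z :: "'h::complex_inner"
  shows "cinner (x + y) z = cinner x z + cinner y z"
  by (subst (1 2 3) cinner_commute) (simp add: cinner_add_right)

lemma cinner_scaleC_left:
  fixes x y :: "'h::complex_inner"
  shows "cinner (c *\<^sub>C x) y = cnj c * cinner x y"
  by (subst (1 2) cinner_commute) (simp add: cinner_scaleC_right)

lemma cinner_zero_right [simp]:
  fixes x :: "'h::complex_inner"
  shows "cinner x 0 = 0"
  using cinner_add_right[of x 0 0] by simp

lemma cinner_zero_left [simp]:
  fixes x :: "'h::complex_inner"
  shows "cinner 0 x = 0"
  using cinner_add_left[of 0 0 x] by simp

lemma cinner_diff_left:
  fixes x y z :: "'h::complex_inner"
  shows "cinner (x - y) z = cinner x z - cinner y z"
  using cinner_add_left[of "x - y" y z] by simp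

lemma cinner_self:
  fixes x :: "'h::complex_inner"
  shows "cinner x x = complex_of_real ((norm x)\<^sup>2)"
proof -
  have "Im (cinner x x) = 0"
    using arg_cong[OF cinner_commute[of x x], of Im] by simp
  then show ?thesis
    by (simp add: norm_eq_sqrt_cinner cinner_ge_zero complex_eq_iff)
qed

text \<open>The norm axioms only give homogeneity for real scalars; the complex case comes from
  expanding the inner product, comparing the squared norms as complex numbers.\<close>

lemma norm_scaleC:
  fixes x :: "'h::complex_inner"
  shows "norm (c *\<^sub>C x) = cmod c * norm x"
proof -
  have "complex_of_real ((norm (c *\<^sub>C x))\<^sup>2) = complex_of_real ((cmod c * norm x)\<^sup>2)"
    unfolding cinner_self[symmetric] cinner_scaleC_left cinner_scaleC_right
      power_mult_distrib of_real_mult complex_norm_square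
    by (simp only: mult_ac)
  then have "(norm (c *\<^sub>C x))\<^sup>2 = (cmod c * norm x)\<^sup>2"
    by (simp only: of_real_eq_iff)
  then show ?thesis
    by (rule power2_eq_imp_eq) simp_all
qed

lemma norm_cinner_le:
  fixes x y :: "'h::complex_inner"
  shows "cmod (cinner x y) \<le> norm x * norm y"
proof (cases "x = 0")
  case False
  \<comment> \<open>This coefficient makes \<open>y + c *\<^sub>C x\<close> the component of
    \<open>y\<close> orthogonal to \<open>x\<close>; the Cauchy-Schwarz inequality says that its
    squared norm is nonnegative.\<close>
  define c where "c = - cinner x y / complex_of_real ((norm x)\<^sup>2)"
  have "norm x \<noteq> 0" using False by simp
  then have c: "c * complex_of_real ((norm x)\<^sup>2) = - cinner x y"
    by (simp add: c_def)
  have "complex_of_real ((norm (y + c *\<^sub>C x))\<^sup>2)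
      = cinner y y + c * cinner y x + cnj c * (cinner x y + c * complex_of_real ((norm x)\<^sup>2))"
    unfolding cinner_self[symmetric]
    by (simp add: cinner_add_left cinner_add_right cinner_scaleC_left cinner_scaleC_right algebra_simps)
  also have "\<dots> = cinner y y + c * cnj (cinner x y)"
    using cinner_commute[of y x] c by simp
  also have "\<dots> = complex_of_real ((norm y)\<^sup>2 - (cmod (cinner x y))\<^sup>2 / (norm x)\<^sup>2)"
    by (simp add: c_def cinner_self complex_norm_square[symmetric])
  finally have "(norm (y + c *\<^sub>C x))\<^sup>2 = (norm y)\<^sup>2 - (cmod (cinner x y))\<^sup>2 / (norm x)\<^sup>2"
    by (simp only: of_real_eq_iff)
  then have "(cmod (cinner x y))\<^sup>2 / (norm x)\<^sup>2 \<le> (norm y)\<^sup>2"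
    by (metis diff_ge_0_iff_ge zero_le_power2)
  then have "(cmod (cinner x y))\<^sup>2 \<le> (norm x * norm y)\<^sup>2"
    using \<open>norm x \<noteq> 0\<close> by (simp add: divide_le_eq power_mult_distrib mult.commute)
  then show ?thesis
    by (rule power2_le_imp_le) simp
qed simp

section \<open>Continuity of the operations and testing on dense sets\<close>

lemma bounded_bilinear_cinner: "bounded_bilinear (cinner :: 'h::complex_inner \<Rightarrow> 'h \<Rightarrow> complex)"
proof (rule bounded_bilinear.intro)
  show "\<exists>K. \<forall>a b :: 'h. cmod (cinner a b) \<le> norm a * norm b * K"
    by (intro exI[of _ 1]) (simp add: norm_cinner_le)
qed (simp_all add: cinner_add_left cinner_add_right scaleR_scaleC cinner_scaleC_left
       cinner_scaleC_right scaleR_conv_of_real)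

lemma bounded_bilinear_scaleC: "bounded_bilinear (scaleC :: complex \<Rightarrow> 'h::complex_inner \<Rightarrow> 'h)"
proof (rule bounded_bilinear.intro)
  show "\<exists>K. \<forall>a (b :: 'h). norm (a *\<^sub>C b) \<le> norm a * norm b * K"
    by (intro exI[of _ 1]) (simp add: norm_scaleC)
qed (simp_all add: scaleC_add_left scaleC_add_right scaleR_scaleC scaleC_scaleC
       scaleR_conv_of_real mult.commute)

lemmas continuous_on_cinner [continuous_intros] =
  bounded_bilinear.continuous_on[OF bounded_bilinear_cinner]

lemmas continuous_on_scaleC [continuous_intros] =
  bounded_bilinear.continuous_on[OF bounded_bilinear_scaleC]

text \<open>By continuity the set where the two functionals agree is closed, so it is the whole
  space; evaluating at \<open>k - k'\<close> then finishes.\<close>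

lemma cinner_ext_dense:
  fixes k k' :: "'h::complex_inner"
  assumes "closure D = UNIV" and eq: "\<And>f. f \<in> D \<Longrightarrow> cinner k f = cinner k' f"
  shows "k = k'"
proof -
  have "closed {f. cinner k f = cinner k' f}"
    by (intro closed_Collect_eq continuous_intros)
  moreover have "D \<subseteq> {f. cinner k f = cinner k' f}"
    using eq by blast
  ultimately have "UNIV \<subseteq> {f. cinner k f = cinner k' f}"
    using assms(1) closure_minimal by metis
  then have "cinner (k - k') (k - k') = 0"
    by (simp add: cinner_diff_left subset_eq)
  then show ?thesis
    by (simp add: cinner_eq_zero_iff)
qed

section \<open>Adjoints\<close>

text \<open>Density makes the vector \<open>k\<close> unique, so the defining identity alone
  describes the graph of the adjoint. Later computations of adjoints go through this form.\<close>

lemma op_adjoint_eq_Some_iff: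
  assumes "densely_defined A"
  shows "op_adjoint A g = Some k \<longleftrightarrow> (\<forall>f\<in>dom A. cinner g (the (A f)) = cinner k f)"
proof -
  let ?P = "\<lambda>k. \<forall>f\<in>dom A. cinner g (the (A f)) = cinner k f"
  have uniq: "k = k'" if "?P k" "?P k'" for k k'
  proof (rule cinner_ext_dense)
    show "closure (dom A) = UNIV"
      using assms by (simp add: densely_defined_def)
    show "cinner k f = cinner k' f" if "f \<in> dom A" for f
      using that \<open>?P k\<close> \<open>?P k'\<close> by (metis (no_types))
  qed
  show ?thesis
  proof
    assume "op_adjoint A g = Some k"
    then have ex: "\<exists>!k. ?P k" and the_k: "(THE k. ?P k) = k"
      unfolding op_adjoint_def by (simp_all only: option.inject option.distinct split: if_splits)
    show "?P k"
      using theI'[OF ex] unfolding the_k .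
  next
    assume k: "?P k"
    then have "\<exists>!k. ?P k"
      using uniq by blast
    moreover have "(THE k. ?P k) = k"
      using k uniq by (intro the_equality) auto
    ultimately show "op_adjoint A g = Some k"
      by (simp add: op_adjoint_def)
  qed
qed

text \<open>Reduces equality of partial functions, domains included, to equality of their
  graphs.\<close>

lemma option_eqI:
  assumes "\<And>k. x = Some k \<longleftrightarrow> y = Some k"
  shows "x = y"
  using assms by (cases y) (metis not_Some_eq)+

lemma linear_operator_op_adjoint:
  assumes "densely_defined A"
  shows "linear_operator (op_adjoint A)"
proof -
  note iff = op_adjoint_eq_Some_iff[OF assms]
  have zero: "op_adjoint A 0 = Some 0"
    by (simp add: iff)
  have add: "op_adjoint A (g + g') = Some (k + k')"
    if "op_adjoint A g = Some k" "op_adjoint A g' = Some k'" for g g' k k'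
    using that by (simp add: iff cinner_add_left)
  have scale: "op_adjoint A (c *\<^sub>C g) = Some (c *\<^sub>C k)"
    if "op_adjoint A g = Some k" for c g k
    using that by (simp add: iff cinner_scaleC_left)
  show ?thesis
    unfolding linear_operator_def complex_vector.subspace_def
  proof (intro conjI ballI allI)
    show "0 \<in> dom (op_adjoint A)"
      using zero by blast
  qed (auto simp: add scale)
qed

text \<open>The graph of the adjoint is an intersection of sets, one for each \<open>f\<close> in
  \<open>dom A\<close>, each closed by continuity of the inner product.\<close>

lemma closed_operator_op_adjoint:
  fixes A :: "'h::complex_inner \<rightharpoonup> 'h"
  assumes "densely_defined A"
  shows "closed_operator (op_adjoint A)"
proof -
  have "{(g, k). op_adjoint A g = Some k}
      = (\<Inter>f\<in>dom A. {p. cinner (fst p) (the (A f)) = cinner (snd p) f})"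
    unfolding op_adjoint_eq_Some_iff[OF assms] by (simp add: set_eq_iff split_beta)
  moreover have "closed \<dots>"
    by (intro closed_INT ballI closed_Collect_eq continuous_intros)
  ultimately show ?thesis
    by (simp add: closed_operator_def)
qed

lemma dd_closed_linear_op_adjoint:
  assumes "densely_defined A" "densely_defined (op_adjoint A)"
  shows "dd_closed_linear (op_adjoint A)"
  using assms
  by (simp add: dd_closed_linear_def linear_operator_op_adjoint closed_operator_op_adjoint)

section \<open>Scalar shifts, and composition with a symmetric map\<close>

lemma dom_op_shift [simp]: "dom (op_shift A z) = dom A"
  by (auto simp: op_shift_def)

lemma op_shift_zero_iff: "op_shift A z f = Some 0 \<longleftrightarrow> A f = Some ((- z) *\<^sub>C f)"
  for A :: "'h::complex_inner \<rightharpoonup> 'h"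
  by (auto simp: op_shift_def add_eq_0_iff2)

lemma densely_defined_op_shift [simp]:
  "densely_defined (op_shift A z) \<longleftrightarrow> densely_defined A"
  by (simp add: densely_defined_def)

lemma op_adjoint_op_shift:
  fixes A :: "'h::complex_inner \<rightharpoonup> 'h"
  assumes "densely_defined A"
  shows "op_adjoint (op_shift A z) = op_shift (op_adjoint A) (cnj z)"
proof (intro ext option_eqI)
  fix g k
  have the_shift: "the (op_shift A z f) = the (A f) + z *\<^sub>C f" if "f \<in> dom A" for f
    using that by (auto simp: op_shift_def)
  have "op_adjoint (op_shift A z) g = Some k \<longleftrightarrow>
      (\<forall>f\<in>dom A. cinner g (the (A f)) = cinner (k - cnj z *\<^sub>C g) f)"
    using assms
    by (auto simp: op_adjoint_eq_Some_iff the_shift cinner_add_right cinner_scaleC_right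
        cinner_diff_left cinner_scaleC_left algebra_simps)
  also have "\<dots> \<longleftrightarrow> op_adjoint A g = Some (k - cnj z *\<^sub>C g)"
    by (simp add: op_adjoint_eq_Some_iff[OF assms])
  also have "\<dots> \<longleftrightarrow> op_shift (op_adjoint A) (cnj z) g = Some k"
    by (auto simp: op_shift_def)
  finally show "op_adjoint (op_shift A z) g = Some k \<longleftrightarrow>
      op_shift (op_adjoint A) (cnj z) g = Some k" .
qed

text \<open>Since \<open>B\<close> is defined everywhere, composing on the left keeps the domain,
  and \<open>B\<close> can be moved across the inner product onto \<open>g\<close>.\<close>

lemma op_adjoint_map_symmetric:
  fixes A :: "'h::complex_inner \<rightharpoonup> 'h"
  assumes A: "densely_defined A"
    and B: "\<And>x y. cinner (B x) y = cinner x (B y)"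
  shows "op_adjoint (\<lambda>f. map_option B (A f)) = (\<lambda>g. op_adjoint A (B g))"
proof (intro ext option_eqI)
  fix g k
  have "dom (\<lambda>f. map_option B (A f)) = dom A"
    by auto
  moreover from this have "densely_defined (\<lambda>f. map_option B (A f))"
    using A by (simp add: densely_defined_def)
  moreover have "the (map_option B (A f)) = B (the (A f))" if "f \<in> dom A" for f
    using that by auto
  ultimately show "op_adjoint (\<lambda>f. map_option B (A f)) g = Some k \<longleftrightarrow> op_adjoint A (B g) = Some k"
    by (simp add: op_adjoint_eq_Some_iff A B)
qed

text \<open>The domain of the composition is the image of \<open>dom A\<close> under
  \<open>C\<close>, the inverse of \<open>B\<close>, and a continuous surjection maps dense sets to
  dense sets.\<close>

lemma densely_defined_comp_homeomorphism:
  fixes A :: "'h::complex_inner \<rightharpoonup> 'h"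
  assumes A: "densely_defined A"
    and cont: "continuous_on UNIV C"
    and BC: "\<And>x. B (C x) = x" and CB: "\<And>x. C (B x) = x"
  shows "densely_defined (\<lambda>g. A (B g))"
proof -
  have "dom (\<lambda>g. A (B g)) = C ` dom A"
  proof
    show "dom (\<lambda>g. A (B g)) \<subseteq> C ` dom A"
      by (force simp: CB intro: image_eqI[of _ C "B _"])
    show "C ` dom A \<subseteq> dom (\<lambda>g. A (B g))"
      by (auto simp: BC)
  qed
  moreover have "C ` closure (dom A) \<subseteq> closure (C ` dom A)"
    using cont
    by (intro image_closure_subset continuous_on_subset[OF cont] closed_closure closure_subset) auto
  moreover have "C ` UNIV = UNIV"
    using CB by (metis surjI)
  ultimately show ?thesis
    using A by (auto simp: densely_defined_def)
qed

text \<open>Counterpart of the left composition rule, used to compute the double adjoint of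
  \<open>T2\<close>. Invertibility of \<open>B\<close> allows the substitution
  \<open>u = B f\<close>, with \<open>u\<close> ranging over \<open>dom A\<close>.\<close>

lemma op_adjoint_comp_symmetric:
  fixes A :: "'h::complex_inner \<rightharpoonup> 'h"
  assumes A: "densely_defined A"
    and cont: "continuous_on UNIV C"
    and BC: "\<And>x. B (C x) = x" and CB: "\<And>x. C (B x) = x"
    and B: "\<And>x y. cinner (B x) y = cinner x (B y)"
  shows "op_adjoint (\<lambda>g. A (B g)) = (\<lambda>f. map_option B (op_adjoint A f))"
proof (intro ext option_eqI)
  fix g k
  \<comment> \<open>The inverse of a symmetric bijection is again symmetric.\<close>
  have C: "cinner x (C y) = cinner (C x) y" for x y
    using B[of "C x" "C y"] by (simp add: BC)
  have dense: "densely_defined (\<lambda>g. A (B g))"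
    using A cont BC CB by (rule densely_defined_comp_homeomorphism)
  have "op_adjoint (\<lambda>g. A (B g)) g = Some k \<longleftrightarrow>
      (\<forall>f. B f \<in> dom A \<longrightarrow> cinner g (the (A (B f))) = cinner k f)"
    by (auto simp: op_adjoint_eq_Some_iff[OF dense] dom_def)
  also have "\<dots> \<longleftrightarrow> (\<forall>u\<in>dom A. cinner g (the (A u)) = cinner k (C u))"
    by (metis BC CB)
  also have "\<dots> \<longleftrightarrow> op_adjoint A g = Some (C k)"
    by (simp add: op_adjoint_eq_Some_iff[OF A] C)
  also have "\<dots> \<longleftrightarrow> map_option B (op_adjoint A g) = Some k"
    by (auto simp: BC CB)
  finally show "op_adjoint (\<lambda>g. A (B g)) g = Some k \<longleftrightarrow> map_option B (op_adjoint A g) = Some k" .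
qed

text \<open>Pairing with \<open>f\<close> gives \<i> times \<open>cinner f f\<close> on one side of
  the symmetry relation and -\<i> times it on the other.\<close>

lemma self_adjoint_no_imaginary_eigenvalue:
  fixes A :: "'h::complex_inner \<rightharpoonup> 'h"
  assumes A: "self_adjoint A" and f: "A f = Some (\<i> *\<^sub>C f)"
  shows "f = 0"
proof -
  have dense: "densely_defined A" and adj: "op_adjoint A f = Some (\<i> *\<^sub>C f)"
    using A f unfolding self_adjoint_def by metis+
  have "cinner f (the (A f)) = cinner (\<i> *\<^sub>C f) f"
    using adj domI[of A, OF f] unfolding op_adjoint_eq_Some_iff[OF dense] by blast
  then have "cinner f f = 0"
    unfolding f option.sel cinner_scaleC_left cinner_scaleC_right by simp
  then show ?thesis
    by (simp add: cinner_eq_zero_iff)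
qed

text \<open>A finite value of \<open>cdim\<close> means that \<open>V\<close> is the span of a
  finite set, so the library dimension applies; the zero space has the empty basis and dimension
  0.\<close>

lemma cdim_one_imp_nonzero:
  assumes "cdim V = 1"
  obtains x where "x \<in> V" "x \<noteq> 0"
proof -
  obtain B where "complex_vector.span B = V" and dim: "complex_vector.dim V = 1"
    using assms unfolding cdim_def one_enat_def by (metis enat.distinct(2) enat.inject)
  then have "0 \<in> V"
    using complex_vector.span_zero by blast
  have "V \<noteq> {0}"
  proof
    assume "V = {0}"
    then have "complex_vector.dim V = card ({} :: 'a set)"
      by (metis complex_vector.dim_span_eq_card_independent complex_vector.independent_empty
          complex_vector.span_empty)
    then show False
      using dim by simp
  qed
  with \<open>0 \<in> V\<close> show thesis
    using that by blast
qed

section \<open>Weak measurability\<close>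

text \<open>Against \<open>h\<close> in \<open>dom S\<close>, the values pair as
  \<open>cinner (the (S h)) (f t)\<close>, which does not involve \<open>T t\<close>. Other
  \<open>h\<close> are limits of such vectors, and pointwise limits preserve measurability.\<close>

lemma weakly_measurable_ops_restrict_op_adjoint:
  fixes S :: "'h::complex_inner \<rightharpoonup> 'h"
  assumes S: "densely_defined S"
    and le: "\<And>t. T t \<subseteq>\<^sub>m op_adjoint S"
  shows "weakly_measurable_ops T"
  unfolding weakly_measurable_ops_def
proof (intro allI impI)
  fix f :: "real \<Rightarrow> 'h"
  assume f: "weakly_measurable f" and dom: "\<forall>t. f t \<in> dom (T t)"
  have eq: "cinner h (the (T t (f t))) = cinner (the (S h)) (f t)" if "h \<in> dom S" for h t
  proof -
    have "T t (f t) = Some (the (T t (f t)))"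
      using dom by (metis domIff option.collapse)
    then have "op_adjoint S (f t) = Some (the (T t (f t)))"
      using le[of t] dom by (simp add: map_le_def)
    then have "cinner (f t) (the (S h)) = cinner (the (T t (f t))) h"
      using that by (simp add: op_adjoint_eq_Some_iff[OF S])
    then show ?thesis
      by (metis cinner_commute)
  qed
  show "weakly_measurable (\<lambda>t. the (T t (f t)))"
    unfolding weakly_measurable_def
  proof
    fix h
    have "h \<in> closure (dom S)"
      using S by (simp add: densely_defined_def)
    then obtain u where u: "\<And>n. u n \<in> dom S" "u \<longlonglongrightarrow> h"
      unfolding closure_sequential by blast
    show "(\<lambda>t. cinner h (the (T t (f t)))) \<in> borel_measurable lebesgue"
    proof (rule borel_measurable_LIMSEQ_metric)
      show "(\<lambda>t. cinner (u n) (the (T t (f t)))) \<in> borel_measurable lebesgue" for n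
        using f by (simp add: eq[OF u(1)] weakly_measurable_def)
      show "(\<lambda>n. cinner (u n) (the (T t (f t)))) \<longlonglongrightarrow> cinner h (the (T t (f t)))" for t
        by (intro bounded_bilinear.tendsto[OF bounded_bilinear_cinner] u tendsto_const)
    qed
  qed
qed

text \<open>A constant family of vectors suffices: its images pair with \<open>h\<close> to a
  function with two values, and the preimage of one of them is \<open>E\<close>.\<close>

lemma not_weakly_measurable_ops_switch:
  fixes S S' :: "'h::complex_inner \<rightharpoonup> 'h"
  assumes E: "E \<notin> sets lebesgue" and f: "f \<in> dom S" "f \<in> dom S'"
    and ne: "cinner h (the (S f)) \<noteq> cinner h (the (S' f))"
  shows "\<not> weakly_measurable_ops (\<lambda>t. if t \<in> E then S else S')"
proof
  let ?T = "\<lambda>t. if t \<in> E then S else S'"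
  assume T: "weakly_measurable_ops ?T"
  have "weakly_measurable (\<lambda>t :: real. f)"
    by (simp add: weakly_measurable_def)
  moreover have "\<forall>t. f \<in> dom (?T t)"
    using f by simp
  ultimately have "weakly_measurable (\<lambda>t. the (?T t f))"
    using T[unfolded weakly_measurable_ops_def, rule_format, of "\<lambda>t. f"] by blast
  then have "(\<lambda>t. cinner h (the (?T t f))) \<in> borel_measurable lebesgue"
    by (simp add: weakly_measurable_def)
  then have "(\<lambda>t. cinner h (the (?T t f))) -` {cinner h (the (S f))} \<inter> space lebesgue
      \<in> sets lebesgue"
    by (rule measurable_sets) simp
  moreover have "(\<lambda>t. cinner h (the (?T t f))) -` {cinner h (the (S f))} \<inter> space lebesgue = E"
    using ne by (auto split: if_splits)
  ultimately show False
    using E by simp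
qed

section \<open>The counterexample\<close>

theorem mainTheorem2:
  fixes A0 A1 T0 T1 :: "'h::chilbert_space \<rightharpoonup> 'h"
    and E :: "real set"
  assumes separable: "separable_space (euclidean :: 'h topology)"
    and A0: "dd_closed_linear A0" "symmetric_operator A0" "deficiency_indices A0 = (1, 1)"
    and A1: "self_adjoint A1" "A0 \<subseteq>\<^sub>m A1"
    and T0: "T0 = op_shift A0 \<i>"
    and T1: "T1 = op_shift A1 \<i>"
    and E: "E \<notin> sets lebesgue"
  shows "(\<exists>e. e \<in> dom (op_adjoint T0) \<and> norm e = 1 \<and> the (op_adjoint T0 e) = 0) \<and>
    (\<forall>e T2 T.
       e \<in> dom (op_adjoint T0) \<and> norm e = 1 \<and> the (op_adjoint T0 e) = 0 \<and>
       T2 = (\<lambda>f. map_option (\<lambda>y. y + cinner e y *\<^sub>C e) (T1 f)) \<and>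
       T = (\<lambda>t::real. if t \<in> E then op_adjoint T1 else op_adjoint T2) \<longrightarrow>
         dd_closed_linear T2 \<and>
         (\<forall>t. dd_closed_linear (T t)) \<and>
         weakly_measurable_ops T \<and>
         (\<forall>t. dd_closed_linear (op_adjoint (T t))) \<and>
         \<not> weakly_measurable_ops (\<lambda>t. op_adjoint (T t)))"
proof (intro conjI allI impI)
  have dense0: "densely_defined A0" and dense1: "densely_defined A1"
    using A0 A1 by (simp_all add: dd_closed_linear_def self_adjoint_def)
  have adj_shift: "op_adjoint (op_shift A1 z) = op_shift A1 (cnj z)" for z
    using A1 by (simp add: op_adjoint_op_shift[OF dense1] self_adjoint_def)
  have adj0: "op_adjoint T0 = op_shift (op_adjoint A0) (- \<i>)"
    by (simp add: T0 op_adjoint_op_shift[OF dense0])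
  have dense_T0: "densely_defined T0" and dense_T1: "densely_defined T1"
    and dense_adj: "densely_defined (op_adjoint T1)"
    using dense0 dense1 by (simp_all add: T0 T1 adj_shift)
  have T1_adj_adj: "op_adjoint (op_adjoint T1) = T1"
    by (simp add: T1 adj_shift)
  have T0_T1: "T0 \<subseteq>\<^sub>m T1"
    using A1(2) by (force simp: T0 T1 map_le_def op_shift_def)
  show "\<exists>e. e \<in> dom (op_adjoint T0) \<and> norm e = 1 \<and> the (op_adjoint T0 e) = 0"
  proof -
    \<comment> \<open>By \<open>adj0\<close>, this kernel is the one measured by the first
      deficiency index.\<close>
    have "cdim (op_kernel (op_adjoint T0)) = 1"
      using A0(3) by (simp add: deficiency_indices_def adj0)
    then obtain x where x: "x \<in> op_kernel (op_adjoint T0)" "x \<noteq> 0"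
      by (rule cdim_one_imp_nonzero)
    define e where "e = complex_of_real (inverse (norm x)) *\<^sub>C x"
    have "norm e = 1"
      using x(2) by (simp add: e_def norm_scaleC norm_inverse)
    moreover have "op_adjoint T0 x = Some 0"
      using x(1) by (auto simp: op_kernel_def)
    then have "op_adjoint T0 e = Some 0"
      by (simp add: op_adjoint_eq_Some_iff[OF dense_T0] e_def cinner_scaleC_left)
    ultimately show ?thesis
      by (metis domI option.sel)
  qed
  fix e :: 'h and T2 :: "'h \<rightharpoonup> 'h" and T :: "real \<Rightarrow> ('h \<rightharpoonup> 'h)"
  assume asm: "e \<in> dom (op_adjoint T0) \<and> norm e = 1 \<and> the (op_adjoint T0 e) = 0 \<and>
       T2 = (\<lambda>f. map_option (\<lambda>y. y + cinner e y *\<^sub>C e) (T1 f)) \<and>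
       T = (\<lambda>t::real. if t \<in> E then op_adjoint T1 else op_adjoint T2)"
  define B where "B y = y + cinner e y *\<^sub>C e" for y
  \<comment> \<open>\<open>B\<close> doubles the component along the unit vector \<open>e\<close>
    and fixes the orthogonal complement. The inverse must halve that component, hence the factor
    -1/2.\<close>
  define C where "C y = y + (- (1/2) * cinner e y) *\<^sub>C e" for y
  have T: "T = (\<lambda>t. if t \<in> E then op_adjoint T1 else op_adjoint T2)"
    and T2: "T2 = (\<lambda>f. map_option B (T1 f))"
    using asm by (simp_all add: B_def[abs_def])
  have adj_e: "op_adjoint T0 e = Some 0" and ee: "cinner e e = 1"
    using asm by (auto simp: cinner_self)
  have cont: "continuous_on UNIV C"
    unfolding C_def by (intro continuous_intros)
  have BC: "B (C y) = y" and CB: "C (B y) = y" for y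
    by (simp_all only: B_def C_def cinner_add_right cinner_scaleC_right ee add.assoc
        scaleC_add_left[symmetric]) simp_all
  have B: "cinner (B x) y = cinner x (B y)" for x y
    using cinner_commute[of x e]
    by (simp add: B_def cinner_add_left cinner_add_right cinner_scaleC_left cinner_scaleC_right)
  have dom_T2: "dom T2 = dom T1"
    by (auto simp: T2)
  then have dense_T2: "densely_defined T2"
    using dense_T1 by (simp add: densely_defined_def)
  have adj2: "op_adjoint T2 = (\<lambda>g. op_adjoint T1 (B g))"
    unfolding T2 using dense_T1 B by (rule op_adjoint_map_symmetric)
  have dense_adj2: "densely_defined (op_adjoint T2)"
    unfolding adj2 using dense_adj cont BC CB by (rule densely_defined_comp_homeomorphism)
  \<comment> \<open>This presents \<open>T2\<close> as an adjoint, so that it is closed, and also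
    identifies the adjoint family off \<open>E\<close>.\<close>
  have T2_adj_adj: "op_adjoint (op_adjoint T2) = T2"
    unfolding adj2 op_adjoint_comp_symmetric[OF dense_adj cont BC CB B]
    by (simp add: T1_adj_adj T2)
  show T2_dcl: "dd_closed_linear T2"
    using dd_closed_linear_op_adjoint[OF dense_adj2] dense_T2 by (simp add: T2_adj_adj)
  have T1_dcl: "dd_closed_linear T1"
    using dd_closed_linear_op_adjoint[OF dense_adj] dense_T1 by (simp add: T1_adj_adj)
  show "dd_closed_linear (T t)" for t
    using dense_T1 dense_T2 dense_adj dense_adj2 by (simp add: T dd_closed_linear_op_adjoint)
  show "dd_closed_linear (op_adjoint (T t))" for t
    using T1_dcl T2_dcl by (simp add: T T1_adj_adj T2_adj_adj)
  show "weakly_measurable_ops T"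
  proof (rule weakly_measurable_ops_restrict_op_adjoint[OF dense_T0])
    \<comment> \<open>The adjoint of \<open>T0\<close> annihilates \<open>e\<close>, so
      \<open>e\<close> is orthogonal to the range of \<open>T0\<close>, and the rank-one term of
      \<open>B\<close> vanishes there.\<close>
    have "B (the (T0 h)) = the (T0 h)" if "h \<in> dom T0" for h
      using adj_e that by (simp add: op_adjoint_eq_Some_iff[OF dense_T0] B_def)
    then have T0_T2: "T0 \<subseteq>\<^sub>m T2"
      using T0_T1 by (force simp: T2 map_le_def)
    \<comment> \<open>Passing to adjoints reverses extensions: a larger domain imposes the defining
      identity on more test vectors.\<close>
    have "op_adjoint S \<subseteq>\<^sub>m op_adjoint T0" if "densely_defined S" "T0 \<subseteq>\<^sub>m S" for S
    proof -
      have "op_adjoint T0 g = Some k" if "op_adjoint S g = Some k" for g k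
        using that \<open>T0 \<subseteq>\<^sub>m S\<close> map_le_implies_dom_le[OF \<open>T0 \<subseteq>\<^sub>m S\<close>]
        by (force simp: op_adjoint_eq_Some_iff[OF dense_T0]
            op_adjoint_eq_Some_iff[OF \<open>densely_defined S\<close>] map_le_def)
      then show ?thesis
        by (force simp: map_le_def)
    qed
    then show "T t \<subseteq>\<^sub>m op_adjoint T0" for t
      using T0_T1 T0_T2 dense_T1 dense_T2 by (simp add: T)
  qed
  \<comment> \<open>Otherwise \<open>e\<close> would lie in the kernel of the adjoint of
    \<open>T1\<close>, making it an eigenvector of the self-adjoint \<open>A1\<close> for \<i>,
    although \<open>norm e = 1\<close>.\<close>
  have "\<exists>f\<in>dom T1. cinner e (the (T1 f)) \<noteq> 0"
  proof (rule ccontr)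
    assume "\<not> ?thesis"
    then have "op_adjoint T1 e = Some 0"
      by (simp add: op_adjoint_eq_Some_iff[OF dense_T1])
    then have "A1 e = Some (\<i> *\<^sub>C e)"
      by (simp add: T1 adj_shift op_shift_zero_iff)
    then have "e = 0"
      using A1(1) self_adjoint_no_imaginary_eigenvalue by blast
    then show False
      using ee by simp
  qed
  then obtain f where f: "f \<in> dom T1" and ne: "cinner e (the (T1 f)) \<noteq> 0"
    by blast
  have "the (T2 f) = B (the (T1 f))"
    using f by (auto simp: T2)
  \<comment> \<open>Pairing with \<open>e\<close> turns \<open>B\<close> into multiplication by 2,
    and a nonzero number differs from its double.\<close>
  then have "cinner e (the (T1 f)) \<noteq> cinner e (the (T2 f))"
    using ne by (simp add: B_def cinner_add_right cinner_scaleC_right ee)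
  then have "\<not> weakly_measurable_ops (\<lambda>t. if t \<in> E then T1 else T2)"
    using E f dom_T2 by (intro not_weakly_measurable_ops_switch) auto
  moreover have "(\<lambda>t. op_adjoint (T t)) = (\<lambda>t. if t \<in> E then T1 else T2)"
    by (auto simp: T T1_adj_adj T2_adj_adj)
  ultimately show "\<not> weakly_measurable_ops (\<lambda>t. op_adjoint (T t))"
    by simp
qed

end
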